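(* For every martingale supporting set $\Gamma\in\mathcal{S}_{MT}$ (in $\mathbb{R}^d\times\mathbb{R}^d$), there exists a unique irreducible convex paving for $\Gamma$.
   Context: For $A\subset\mathbb{R}^d$, $V(A)$ is the lowest-dimensional affine space containing $A$, and $IC(A):=\mathrm{int}(\mathrm{conv}(A))$ with interior taken in the topology of $V(A)$ (so $IC(\{x\})=\{x\}$). A convex set $C$ is called open if it is open in $V(C)$. For $\Gamma\subset\mathbb{R}^d\times\mathbb{R}^d$: $\Gamma_x:=\{y:(x,y)\in\Gamma\}$ and $X_\Gamma$ is the projection of $\Gamma$ on the first coordinate. $\mathcal{S}_{MT}$ is the class of Borel sets $\Gamma\subset\mathbb{R}^d\times\mathbb{R}^d$ such that $x\in IC(\Gamma_x)$ for every $x\in X_\Gamma$ (martingale supporting sets). A family $\Phi$ of mutually disjoint open convex sets in $\mathbb{R}^d$ (each $C\in\Phi$ being open in the topology of $V(C)$, the lowest-dimensional affine space containing $C$) is a convex paving for $\Gamma$ if: (1) $X_\Gamma\subset\bigcup_{C\in\Phi}C$; (2) each $C\in\Phi$ contains at least one $x\in X_\Gamma$ ($C$ is then denoted $C(x)$); (3) for any $z,x\in X_\Gamma$, $IC(\Gamma_z)\cap C(x)\ne\emptyset$ implies $IC(\Gamma_z)\subset C(x)$. A convex paving $\Phi$ for $\Gamma$ is irreducible if for any other convex paving $\Psi$ for $\Gamma$: whenever $C\in\Phi$, $D\in\Psi$ satisfy $C\cap D\neq\emptyset$, then $C\subset D$. *)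

theory Defs
  imports "HOL-Analysis.Analysis"
begin

text \<open>The affine space \<open>V(A)\<close> is \<open>affine hull A\<close>; the fibre \<open>\<Gamma>\<^sub>x\<close> is the relational image
  \<open>\<Gamma> `` {x}\<close>, and the first projection \<open>X\<^sub>\<Gamma>\<close> is \<open>Domain \<Gamma>\<close>.\<close>

definition IC :: "(real ^ 'd) set \<Rightarrow> (real ^ 'd) set" where
  "IC A = top_of_set (affine hull A) interior_of (convex hull A)"

lemma IC_eq_rel_interior: "IC A = rel_interior (convex hull A)"
  unfolding IC_def interior_of_def rel_interior_def by (simp add: affine_hull_convex_hull)

definition open_convex :: "(real ^ 'd) set \<Rightarrow> bool" where
  "open_convex C \<longleftrightarrow> convex C \<and> openin (top_of_set (affine hull C)) C"

definition martingale_supporting :: "((real ^ 'd) \<times> (real ^ 'd)) set \<Rightarrow> bool" where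
  "martingale_supporting \<Gamma> \<longleftrightarrow> \<Gamma> \<in> sets borel \<and> (\<forall>x\<in>Domain \<Gamma>. x \<in> IC (\<Gamma> `` {x}))"

text \<open>In the last clause, \<open>C\<close> with \<open>x \<in> C\<close> is the member \<open>C(x)\<close> of the family; it is
  the only one containing \<open>x\<close>, by disjointness.\<close>

definition convex_paving ::
    "((real ^ 'd) \<times> (real ^ 'd)) set \<Rightarrow> (real ^ 'd) set set \<Rightarrow> bool" where
  "convex_paving \<Gamma> \<Phi> \<longleftrightarrow>
     (\<forall>C\<in>\<Phi>. open_convex C) \<and>
     disjoint \<Phi> \<and>
     Domain \<Gamma> \<subseteq> \<Union>\<Phi> \<and>
     (\<forall>C\<in>\<Phi>. \<exists>x\<in>Domain \<Gamma>. x \<in> C) \<and>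
     (\<forall>z\<in>Domain \<Gamma>. \<forall>x\<in>Domain \<Gamma>. \<forall>C\<in>\<Phi>. x \<in> C \<longrightarrow>
        IC (\<Gamma> `` {z}) \<inter> C \<noteq> {} \<longrightarrow> IC (\<Gamma> `` {z}) \<subseteq> C)"

definition irreducible_convex_paving ::
    "((real ^ 'd) \<times> (real ^ 'd)) set \<Rightarrow> (real ^ 'd) set set \<Rightarrow> bool" where
  "irreducible_convex_paving \<Gamma> \<Phi> \<longleftrightarrow>
     convex_paving \<Gamma> \<Phi> \<and>
     (\<forall>\<Psi>. convex_paving \<Gamma> \<Psi> \<and> \<Psi> \<noteq> \<Phi> \<longrightarrow>
        (\<forall>C\<in>\<Phi>. \<forall>D\<in>\<Psi>. C \<inter> D \<noteq> {} \<longrightarrow> C \<subseteq> D))"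

end

theory Submission
  imports Defs
begin

text \<open>Intersecting over all pavings of \<open>\<Gamma>\<close> the member through \<open>x\<close> yields a convex set, the core
  of \<open>x\<close>. As every paving partitions, two cores are equal or disjoint (\<open>paving_core_eq\<close>), and a set
  \<open>IC (\<Gamma> `` {z})\<close> that meets a core lies in it (\<open>IC_subset_paving_core\<close>). The cores thus behave
  like a paving finer than all others, except that an intersection of infinitely many relatively
  open sets might not be relatively open.

  Openness is restored by cutting each core along its faces. A finite-dimensional convex set is the
  disjoint union of the relative interiors of its faces (\<open>face_rel_interior_cover\<close> and
  \<open>face_of_eq\<close>), and a relatively open convex subset lies in a single one of these pieces
  (\<open>rel_open_subset_face_rel_interior\<close>); as \<open>IC (\<Gamma> `` {z})\<close> is such a subset, no
  such set is cut. The pieces that meet the first projection of \<open>\<Gamma>\<close> therefore form a paving, each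
  of whose members lies in a core and hence in the members of any other paving that it meets.

  For uniqueness, each member of one irreducible paving meets a member of the other, and
  irreducibility on both sides gives inclusions in both directions.\<close>

section \<open>Decomposing a convex set into relative interiors of faces\<close>

text \<open>The face is the smallest one containing \<open>x\<close>: were \<open>x\<close> on its relative boundary, a
  supporting hyperplane at \<open>x\<close> would cut out a smaller face still containing \<open>x\<close>.\<close>

lemma face_rel_interior_cover:
  fixes S :: "'a::euclidean_space set"
  assumes "convex S" "x \<in> S"
  obtains F where "F face_of S" "x \<in> rel_interior F"
proof -
  define F where "F = \<Inter>{T. T face_of S \<and> x \<in> T}"
  have face: "F face_of S"
    unfolding F_def using assms by (intro face_of_Inter) (auto intro: face_of_refl)
  have xF: "x \<in> F"
    unfolding F_def by auto
  have convF: "convex F"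
    using face by (rule face_of_imp_convex)
  have "x \<in> rel_interior F"
  proof (rule ccontr)
    assume "x \<notin> rel_interior F"
    then obtain a where le: "\<And>y. y \<in> F \<Longrightarrow> a \<bullet> x \<le> a \<bullet> y"
      and less: "\<And>y. y \<in> rel_interior F \<Longrightarrow> a \<bullet> x < a \<bullet> y"
      using supporting_hyperplane_rel_boundary[OF convF xF] by metis
    have "F \<inter> {y. a \<bullet> y = a \<bullet> x} face_of S"
      using face_of_Int_supporting_hyperplane_ge[OF convF le] face by (rule face_of_trans)
    with xF have "F \<subseteq> F \<inter> {y. a \<bullet> y = a \<bullet> x}"
      unfolding F_def by blast
    moreover obtain y where "y \<in> rel_interior F"
      using rel_interior_eq_empty[OF convF] xF by blast
    ultimately show False
      using less[of y] rel_interior_subset[of F] by auto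
  qed
  with face that show thesis by blast
qed

text \<open>Each point of \<open>U\<close> lies in the relative interior of some face. As \<open>U\<close> is relatively open, a
  face meeting it contains it, so the face of any point of \<open>U\<close> and \<open>F\<close> each contain points of the
  relative interior of the other and must coincide.\<close>

lemma rel_open_subset_face_rel_interior:
  fixes S :: "'a::euclidean_space set"
  assumes "convex S" "F face_of S" "U \<subseteq> S" "rel_interior U = U" "U \<inter> rel_interior F \<noteq> {}"
  shows "U \<subseteq> rel_interior F"
proof
  fix u assume u: "u \<in> U"
  then have "u \<in> S"
    using assms(3) by blast
  then obtain G where G: "G face_of S" "u \<in> rel_interior G"
    by (rule face_rel_interior_cover[OF assms(1)])
  have UF: "U \<subseteq> F"
    using assms rel_interior_subset[of F] by (intro subset_of_face_of[OF assms(2)]) auto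
  have UG: "U \<subseteq> G"
    using assms G u rel_interior_subset[of G] by (intro subset_of_face_of[OF G(1)]) auto
  have "G \<subseteq> F"
    using UF u G face_of_imp_subset[OF G(1)] by (intro subset_of_face_of[OF assms(2)]) auto
  moreover have "F \<subseteq> G"
    using UG assms(5) face_of_imp_subset[OF assms(2)] by (intro subset_of_face_of[OF G(1)]) auto
  ultimately have "F = G"
    by (rule subset_antisym[rotated])
  with G(2) show "u \<in> rel_interior F"
    by simp
qed

lemma open_convex_rel_interior:
  assumes "convex S"
  shows "open_convex (rel_interior S)"
  unfolding open_convex_def rel_interior_eq[symmetric]
  using assms by (intro conjI convex_rel_interior rel_interior_rel_interior)

section \<open>Cores: intersecting all pavings\<close>

lemma convex_paving_member_unique:
  assumes "convex_paving \<Gamma> \<Psi>" "C \<in> \<Psi>" "D \<in> \<Psi>" "C \<inter> D \<noteq> {}"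
  shows "C = D"
proof -
  have "disjoint \<Psi>"
    using assms(1) unfolding convex_paving_def by simp
  with assms(2-4) show ?thesis
    unfolding disjoint_def by blast
qed

lemma convex_paving_member_exists:
  assumes "convex_paving \<Gamma> \<Psi>" "x \<in> Domain \<Gamma>"
  obtains D where "D \<in> \<Psi>" "x \<in> D"
proof -
  have "Domain \<Gamma> \<subseteq> \<Union>\<Psi>"
    using assms(1) unfolding convex_paving_def by simp
  with assms(2) show thesis
    by (auto intro: that)
qed

definition paving_core :: "((real ^ 'd) \<times> (real ^ 'd)) set \<Rightarrow> real ^ 'd \<Rightarrow> (real ^ 'd) set" where
  "paving_core \<Gamma> x = \<Inter>{D. \<exists>\<Psi>. convex_paving \<Gamma> \<Psi> \<and> D \<in> \<Psi> \<and> x \<in> D}"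

lemma paving_core_self: "x \<in> paving_core \<Gamma> x"
  unfolding paving_core_def by blast

lemma convex_paving_core: "convex (paving_core \<Gamma> x)"
  unfolding paving_core_def
  by (rule convex_Inter) (auto simp: convex_paving_def open_convex_def)

lemma paving_core_subset:
  "convex_paving \<Gamma> \<Psi> \<Longrightarrow> D \<in> \<Psi> \<Longrightarrow> x \<in> D \<Longrightarrow> paving_core \<Gamma> x \<subseteq> D"
  unfolding paving_core_def by blast

text \<open>A common point of the two cores puts \<open>x\<close> and \<open>y\<close> into the same member of every paving, so
  both cores are intersections of the same sets.\<close>

lemma paving_core_eq:
  assumes "x \<in> Domain \<Gamma>" "y \<in> Domain \<Gamma>" "paving_core \<Gamma> x \<inter> paving_core \<Gamma> y \<noteq> {}"
  shows "paving_core \<Gamma> x = paving_core \<Gamma> y"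
proof -
  obtain p where p: "p \<in> paving_core \<Gamma> x" "p \<in> paving_core \<Gamma> y"
    using assms(3) by blast
  have same_member: "v \<in> D"
    if D: "convex_paving \<Gamma> \<Psi>" "D \<in> \<Psi>" "u \<in> D" and v: "v \<in> Domain \<Gamma>"
      and p: "p \<in> paving_core \<Gamma> u" "p \<in> paving_core \<Gamma> v" for u v D \<Psi>
  proof -
    obtain E where E: "E \<in> \<Psi>" "v \<in> E"
      using convex_paving_member_exists[OF D(1) v] .
    have "p \<in> D" "p \<in> E"
      using paving_core_subset[OF D] paving_core_subset[OF D(1) E] p by auto
    then have "D = E"
      using convex_paving_member_unique[OF D(1,2) E(1)] by blast
    with E show ?thesis by simp
  qed
  have "(convex_paving \<Gamma> \<Psi> \<and> D \<in> \<Psi> \<and> x \<in> D) \<longleftrightarrow> (convex_paving \<Gamma> \<Psi> \<and> D \<in> \<Psi> \<and> y \<in> D)" for D \<Psi>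
    using same_member[of \<Psi> D x y] same_member[of \<Psi> D y x] assms(1,2) p by blast
  then show ?thesis
    unfolding paving_core_def by presburger
qed

lemma IC_subset_paving_core:
  assumes "x \<in> Domain \<Gamma>" "z \<in> Domain \<Gamma>" "IC (\<Gamma> `` {z}) \<inter> paving_core \<Gamma> x \<noteq> {}"
  shows "IC (\<Gamma> `` {z}) \<subseteq> paving_core \<Gamma> x"
proof -
  have "IC (\<Gamma> `` {z}) \<subseteq> D" if D: "convex_paving \<Gamma> \<Psi>" "D \<in> \<Psi>" "x \<in> D" for D \<Psi>
  proof -
    have "IC (\<Gamma> `` {z}) \<inter> D \<noteq> {}"
      using assms(3) paving_core_subset[OF D] by blast
    moreover have "\<forall>z\<in>Domain \<Gamma>. \<forall>x\<in>Domain \<Gamma>. \<forall>C\<in>\<Psi>. x \<in> C \<longrightarrow>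
        IC (\<Gamma> `` {z}) \<inter> C \<noteq> {} \<longrightarrow> IC (\<Gamma> `` {z}) \<subseteq> C"
      using D(1) unfolding convex_paving_def by simp
    ultimately show ?thesis
      using D(2,3) assms(1,2) by simp
  qed
  then show ?thesis
    unfolding paving_core_def by blast
qed

section \<open>The irreducible paving\<close>

text \<open>The point \<open>x\<close> has a double role: it names the core to be cut, and it keeps only those pieces
  that contain a point of the domain, as every member of a paving must.\<close>

definition core_face_paving :: "((real ^ 'd) \<times> (real ^ 'd)) set \<Rightarrow> (real ^ 'd) set set" where
  "core_face_paving \<Gamma> =
     {rel_interior F | x F. x \<in> Domain \<Gamma> \<and> F face_of paving_core \<Gamma> x \<and> x \<in> rel_interior F}"

lemma core_face_pavingE:
  assumes "C \<in> core_face_paving \<Gamma>"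
  obtains x F where "C = rel_interior F" "x \<in> Domain \<Gamma>" "F face_of paving_core \<Gamma> x"
    "x \<in> rel_interior F" "C \<subseteq> paving_core \<Gamma> x"
  using assms rel_interior_subset face_of_imp_subset unfolding core_face_paving_def by blast

lemma convex_paving_core_face_paving: "convex_paving \<Gamma> (core_face_paving \<Gamma>)"
proof -
  have "open_convex C" if "C \<in> core_face_paving \<Gamma>" for C
    using that by (elim core_face_pavingE) (auto intro: open_convex_rel_interior face_of_imp_convex)
  moreover have "C = D"
    if C: "C \<in> core_face_paving \<Gamma>" and D: "D \<in> core_face_paving \<Gamma>" and meet: "C \<inter> D \<noteq> {}" for C D
  proof -
    obtain x F where F: "C = rel_interior F" "x \<in> Domain \<Gamma>" "F face_of paving_core \<Gamma> x"
        "C \<subseteq> paving_core \<Gamma> x"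
      using C by (rule core_face_pavingE)
    obtain y G where G: "D = rel_interior G" "y \<in> Domain \<Gamma>" "G face_of paving_core \<Gamma> y"
        "D \<subseteq> paving_core \<Gamma> y"
      using D by (rule core_face_pavingE)
    have "paving_core \<Gamma> x = paving_core \<Gamma> y"
      using F G meet by (intro paving_core_eq) auto
    with F G meet show ?thesis
      using face_of_eq[of F "paving_core \<Gamma> x" G] by simp
  qed
  then have "disjoint (core_face_paving \<Gamma>)"
    unfolding disjoint_def by blast
  moreover have "Domain \<Gamma> \<subseteq> \<Union>(core_face_paving \<Gamma>)"
  proof
    fix x assume x: "x \<in> Domain \<Gamma>"
    obtain F where "F face_of paving_core \<Gamma> x" "x \<in> rel_interior F"
      using face_rel_interior_cover[OF convex_paving_core paving_core_self] .
    with x show "x \<in> \<Union>(core_face_paving \<Gamma>)"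
      unfolding core_face_paving_def by blast
  qed
  moreover have "\<exists>x\<in>Domain \<Gamma>. x \<in> C" if "C \<in> core_face_paving \<Gamma>" for C
    using that by (elim core_face_pavingE) auto
  moreover have "IC (\<Gamma> `` {z}) \<subseteq> C"
    if z: "z \<in> Domain \<Gamma>" and C: "C \<in> core_face_paving \<Gamma>" and meet: "IC (\<Gamma> `` {z}) \<inter> C \<noteq> {}" for z C
  proof -
    obtain x F where F: "C = rel_interior F" "x \<in> Domain \<Gamma>" "F face_of paving_core \<Gamma> x"
        "C \<subseteq> paving_core \<Gamma> x"
      using C by (rule core_face_pavingE)
    have "IC (\<Gamma> `` {z}) \<subseteq> paving_core \<Gamma> x"
      using F z meet by (intro IC_subset_paving_core) auto
    moreover have "rel_interior (IC (\<Gamma> `` {z})) = IC (\<Gamma> `` {z})"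
      by (simp add: IC_eq_rel_interior rel_interior_rel_interior)
    ultimately show ?thesis
      using F meet convex_paving_core rel_open_subset_face_rel_interior by blast
  qed
  ultimately show ?thesis
    unfolding convex_paving_def by simp
qed

lemma core_face_paving_refines:
  assumes "convex_paving \<Gamma> \<Psi>" "C \<in> core_face_paving \<Gamma>" "D \<in> \<Psi>" "C \<inter> D \<noteq> {}"
  shows "C \<subseteq> D"
proof -
  obtain x where x: "x \<in> Domain \<Gamma>" "C \<subseteq> paving_core \<Gamma> x"
    using assms(2) by (rule core_face_pavingE)
  obtain E where E: "E \<in> \<Psi>" "x \<in> E"
    using convex_paving_member_exists[OF assms(1) x(1)] .
  have "C \<subseteq> E"
    using x(2) paving_core_subset[OF assms(1) E] by blast
  moreover from this have "E = D"
    using convex_paving_member_unique[OF assms(1) E(1) assms(3)] assms(4) by blast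
  ultimately show ?thesis by simp
qed

lemma irreducible_convex_paving_subset:
  assumes "irreducible_convex_paving \<Gamma> \<Phi>" "irreducible_convex_paving \<Gamma> \<Psi>"
  shows "\<Phi> \<subseteq> \<Psi>"
proof (cases "\<Phi> = \<Psi>")
  case False
  show ?thesis
  proof
    fix C assume C: "C \<in> \<Phi>"
    have pavings: "convex_paving \<Gamma> \<Phi>" "convex_paving \<Gamma> \<Psi>"
      using assms unfolding irreducible_convex_paving_def by auto
    obtain x where x: "x \<in> Domain \<Gamma>" "x \<in> C"
      using pavings(1) C unfolding convex_paving_def by metis
    obtain D where D: "D \<in> \<Psi>" "x \<in> D"
      using convex_paving_member_exists[OF pavings(2) x(1)] .
    have "C \<inter> D \<noteq> {}" "D \<inter> C \<noteq> {}"
      using x D by auto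
    then have "C \<subseteq> D" "D \<subseteq> C"
      using assms False C D(1) unfolding irreducible_convex_paving_def by metis+
    with D show "C \<in> \<Psi>" by simp
  qed
qed simp

theorem theorem2p8:
  fixes \<Gamma> :: "((real ^ 'd) \<times> (real ^ 'd)) set"
  assumes "martingale_supporting \<Gamma>"
  shows "\<exists>!\<Phi>. irreducible_convex_paving \<Gamma> \<Phi>"
proof (rule ex1I)
  show "irreducible_convex_paving \<Gamma> (core_face_paving \<Gamma>)"
    unfolding irreducible_convex_paving_def
    using convex_paving_core_face_paving core_face_paving_refines by blast
  then show "\<Phi> = core_face_paving \<Gamma>" if "irreducible_convex_paving \<Gamma> \<Phi>" for \<Phi>
    using that irreducible_convex_paving_subset by blast
qed

end
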